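(* Let $3\le k<\ell$ be integers with $k\nmid\ell$ and $\ell\ge 20k^2$. Suppose that $G$ is a $k$-uniform hypergraph that contains no homomorphic copy of $C^k_\ell$ and satisfies $\delta_{k-1}(G)>\frac13|V(G)|$. Then there exists a vertex set $B\subseteq V(G)$ with $\frac{|V(G)|}{3}\le |B|\le \frac{2|V(G)|}{3}$ such that for every $e\in E(G)$, both $|e\cap B|$ and $|e\cap (V(G)\setminus B)|$ are odd. In particular, $k$ has to be even.
   Context: A $k$-uniform hypergraph $G$ has a finite vertex set $V(G)$ and an edge set $E(G)$ consisting of $k$-element subsets of $V(G)$. The codegree of a $(k-1)$-subset $S\subseteq V(G)$ is $|\{v\in V(G): S\cup\{v\}\in E(G)\}|$, where only $k$-sets $S\cup\{v\}$ count, and $\delta_{k-1}(G)$ is the minimum codegree over all $(k-1)$-subsets of $V(G)$ (it is understood that $|V(G)|\ge k-1$, so that this is a minimum over a nonempty collection). For $\ell\ge k+1$, the tight cycle $C^k_\ell$ is the $k$-uniform hypergraph on $\ell$ distinct vertices $v_1,\dots,v_\ell$ with edges $\{v_i,v_{i+1},\dots,v_{i+k-1}\}$ for all $i\in\{1,\dots,\ell\}$, indices modulo $\ell$. $G$ contains a homomorphic copy of a $k$-uniform hypergraph $F$ if there is a map $\phi:V(F)\to V(G)$ such that $\{\phi(v_1),\dots,\phi(v_k)\}\in E(G)$ (in particular a set of size $k$) for every edge $\{v_1,\dots,v_k\}\in E(F)$. *)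

theory Defs
  imports Complex_Main
begin

definition uniform_hypergraph :: "nat \<Rightarrow> 'a set \<Rightarrow> 'a set set \<Rightarrow> bool" where
  "uniform_hypergraph k V E \<longleftrightarrow> finite V \<and> (\<forall>e\<in>E. e \<subseteq> V \<and> card e = k)"

text \<open>In a k-uniform hypergraph, a vertex of a (k-1)-set S never contributes to the codegree of S,
  since then \<open>insert v S\<close> is S, which is too small to be an edge.\<close>

definition codegree :: "'a set \<Rightarrow> 'a set set \<Rightarrow> 'a set \<Rightarrow> nat" where
  "codegree V E S = card {v \<in> V. insert v S \<in> E}"

text \<open>The minimum below is meaningful only if the vertex set is finite and has at least k-1
  elements; otherwise \<open>Min\<close> is unspecified.\<close>

definition min_codegree :: "nat \<Rightarrow> 'a set \<Rightarrow> 'a set set \<Rightarrow> nat" where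
  "min_codegree k V E = Min (codegree V E ` {S. S \<subseteq> V \<and> card S = k - 1})"

text \<open>The tight cycle on l vertices has vertices 0, ..., l-1 (instead of 1, ..., l); it is
  intended for \<open>l > k\<close>.\<close>

definition tight_cycle_verts :: "nat \<Rightarrow> nat set" where
  "tight_cycle_verts l = {..<l}"

definition tight_cycle_edges :: "nat \<Rightarrow> nat \<Rightarrow> nat set set" where
  "tight_cycle_edges k l = (\<lambda>i. (\<lambda>j. (i + j) mod l) ` {..<k}) ` {..<l}"

text \<open>If both hypergraphs are k-uniform, \<open>\<phi> ` e \<in> E\<close> forces \<open>\<phi>\<close> to be injective on
  each edge e; globally \<open>\<phi>\<close> need not be injective.\<close>

definition contains_hom_copy ::
  "'a set \<Rightarrow> 'a set set \<Rightarrow> 'b set \<Rightarrow> 'b set set \<Rightarrow> bool" where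
  "contains_hom_copy V E VF EF \<longleftrightarrow>
     (\<exists>\<phi>. \<phi> ` VF \<subseteq> V \<and> (\<forall>e\<in>EF. \<phi> ` e \<in> E))"

end

theory Submission
  imports Defs "HOL-Combinatorics.Permutations"
begin

text \<open>
  A homomorphic copy of the tight cycle of length \<open>l\<close> is a closed walk of length \<open>l\<close> through the
  edges. A walk overwrites the \<open>k\<close> slots of a labelled edge cyclically, so what is needed for such a
  walk is a sequence of about \<open>l div k\<close> changes of single slots that leads from a labelled edge to the
  same edge with rotated slots (\<open>hom_copy_if_rotation\<close>). Since \<open>l \<ge> 20 k\<^sup>2\<close>, there is
  room for this if every transposition of two slots takes at most 17 changes. As there is no such
  walk, this fails for every edge (\<open>not_all_swaps\<close>).

  Two vertices of an edge \<open>e\<close> can be swapped if \<open>e - x\<close> and \<open>e - y\<close> have a common neighbour. By the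
  codegree bound this happens for some pair among any three vertices of \<open>e\<close>. So the graph of these
  pairs on \<open>e\<close> would generate all transpositions cheaply, unless it consists of exactly two disjoint
  cliques, the classes of \<open>e\<close>. By the same argument a vertex that replaces \<open>y \<in> e\<close> inherits the
  class of \<open>y\<close>, since otherwise a swap in the new edge would give a swap across the classes of
  \<open>e\<close> (\<open>slot_adj_if_swaps\<close>, \<open>adj_exchange\<close>).

  It remains to see that the classes of all edges are induced by one vertex set \<open>B\<close>. If this is so,
  and all edges meet \<open>B\<close> in odd sets of vertices with \<open>k\<close> even, then the two vertices
  completing a \<open>(k-2)\<close>-set \<open>T\<close> to an edge are on different sides of \<open>B\<close> iff \<open>T \<inter> B\<close> is even.
  Conversely, call \<open>T\<close> crossing if these two vertices are in different classes, which turns out to depend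
  only on \<open>T\<close> (\<open>crossing_link\<close>). The set \<open>B\<close> is recovered from the crossing family: \<open>u\<close> and \<open>v\<close> are
  on different sides if exchanging \<open>u\<close> for \<open>v\<close> changes whether a set is crossing. That this does not
  depend on the set amounts to a parity condition on 4-cycles (\<open>four_cycle_even\<close>), the main
  difficulty, where links with two components have to be excluded as a source of inconsistency. Given
  \<open>B\<close>, the parity of \<open>e \<inter> B\<close> is the same for all edges, and an even parity, for \<open>B\<close> or for its
  complement, contradicts the codegree bound (\<open>not_all_even\<close>).
\<close>

section \<open>Codegrees and neighbourhoods\<close>

definition nbh :: "'a set \<Rightarrow> 'a set set \<Rightarrow> 'a set \<Rightarrow> 'a set" where
  "nbh V E S = {v \<in> V. insert v S \<in> E}"

locale dense_hypergraph =
  fixes k :: nat and V :: "'a set" and E :: "'a set set"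
  assumes k_ge_3: "3 \<le> k"
    and fin_V: "finite V"
    and edge_sub: "e \<in> E \<Longrightarrow> e \<subseteq> V"
    and edge_card: "e \<in> E \<Longrightarrow> card e = k"
    and card_V_ge: "k - 1 \<le> card V"
    and dense: "S \<subseteq> V \<Longrightarrow> card S = k - 1 \<Longrightarrow> card V < 3 * card (nbh V E S)"
begin

abbreviation N :: "'a set \<Rightarrow> 'a set" where "N \<equiv> nbh V E"

lemma edge_finite: "e \<in> E \<Longrightarrow> finite e"
  using edge_sub fin_V finite_subset by blast

lemma card_edge_split:
  assumes "e \<in> E" and "B \<subseteq> V"
  shows "card (e \<inter> B) + card (e \<inter> (V - B)) = k"
proof -
  have "(e \<inter> B) \<union> (e \<inter> (V - B)) = e" using edge_sub[OF assms(1)] by blast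
  moreover have "card ((e \<inter> B) \<union> (e \<inter> (V - B))) = card (e \<inter> B) + card (e \<inter> (V - B))"
    using edge_finite[OF assms(1)] by (intro card_Un_disjoint) auto
  ultimately show ?thesis using edge_card[OF assms(1)] by simp
qed

lemma finite_N: "finite (N S)"
  using fin_V by (simp add: nbh_def)

lemma N_not_mem:
  assumes "card S = k - 1" and "w \<in> N S"
  shows "w \<notin> S"
proof
  assume "w \<in> S"
  then have "S \<in> E" using assms(2) by (simp add: nbh_def insert_absorb)
  then show False using edge_card assms(1) k_ge_3 by force
qed

lemma N_nonempty: "S \<subseteq> V \<Longrightarrow> card S = k - 1 \<Longrightarrow> N S \<noteq> {}"
  using dense[of S] by (cases "N S = {}") auto

lemma edge_minus_vertex:
  assumes "e \<in> E" and "x \<in> e"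
  shows "e - {x} \<subseteq> V" and "card (e - {x}) = k - 1"
  using assms edge_sub[of e] edge_card[of e] by auto

text \<open>Three sets that are each larger than a third of the vertex set cannot be pairwise disjoint. In
  this form the codegree bound enters nearly everywhere.\<close>

lemma two_of_three_meet:
  assumes "S \<subseteq> V" "S' \<subseteq> V" "S'' \<subseteq> V"
    and "card S = k - 1" "card S' = k - 1" "card S'' = k - 1"
  shows "N S \<inter> N S' \<noteq> {} \<or> N S \<inter> N S'' \<noteq> {} \<or> N S' \<inter> N S'' \<noteq> {}"
proof (rule ccontr)
  assume "\<not> ?thesis"
  then have "card (N S \<union> N S' \<union> N S'') = card (N S) + card (N S') + card (N S'')"
    by (simp add: card_Un_disjoint finite_N Int_Un_distrib2)
  moreover have "card (N S \<union> N S' \<union> N S'') \<le> card V"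
    by (intro card_mono fin_V) (auto simp: nbh_def)
  ultimately show False
    using dense[of S] dense[of S'] dense[of S''] assms by linarith
qed

section \<open>Closed walks of labelled edges\<close>

text \<open>A tight walk is a sequence of vertices in which any \<open>k\<close> consecutive ones form an edge. Writing
  the vertex at time \<open>t\<close> into slot \<open>t mod k\<close>, one sees a labelled edge in which each step overwrites
  one slot. The slots are \<open>{..<k}\<close>.\<close>

definition labelling :: "(nat \<Rightarrow> 'a) \<Rightarrow> bool" where
  "labelling f \<longleftrightarrow> f ` {..<k} \<in> E"

definition move :: "(nat \<Rightarrow> 'a) \<Rightarrow> (nat \<Rightarrow> 'a) \<Rightarrow> bool" where
  "move f g \<longleftrightarrow> labelling f \<and> labelling g \<and> (\<exists>a<k. \<exists>w. g = f(a := w))"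

lemma labelling_inj: "labelling f \<Longrightarrow> inj_on f {..<k}"
  by (intro eq_card_imp_inj_on) (auto simp: labelling_def edge_card)

lemma labelling_comp: "labelling f \<Longrightarrow> \<pi> permutes {..<k} \<Longrightarrow> labelling (f \<circ> \<pi>)"
  unfolding labelling_def image_comp[symmetric] by (simp add: permutes_image)

lemma labelling_exists:
  assumes "e \<in> E"
  obtains f where "labelling f" and "f ` {..<k} = e"
proof -
  from ex_bij_betw_nat_finite[OF edge_finite[OF assms]]
  obtain f where "bij_betw f {..<k} e"
    using edge_card[OF assms] by (auto simp: lessThan_atLeast0)
  then show thesis using that assms by (auto simp: labelling_def bij_betw_def)
qed

lemma move_refl: "labelling f \<Longrightarrow> move f f"
  unfolding move_def using k_ge_3 by (auto intro!: exI[of _ 0] exI[of _ "f 0"])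

lemma move_sym: "move f g \<Longrightarrow> move g f"
  unfolding move_def by (metis fun_upd_triv fun_upd_upd)

lemma move_comp:
  assumes "move f g" and p: "\<pi> permutes {..<k}"
  shows "move (f \<circ> \<pi>) (g \<circ> \<pi>)"
proof -
  obtain a w where "a < k" and g: "g = f(a := w)" using assms(1) by (auto simp: move_def)
  have "g \<circ> \<pi> = (f \<circ> \<pi>)(inv \<pi> a := w)"
    using p unfolding g by (auto simp: fun_eq_iff permutes_inverses)
  moreover have "inv \<pi> a < k"
    using \<open>a < k\<close> permutes_in_image[OF permutes_inv[OF p], of a] by simp
  ultimately show ?thesis
    using assms(1) labelling_comp[OF _ p] unfolding move_def by blast
qed

lemma moves_comp:
  assumes "\<pi> permutes {..<k}"
  shows "(move ^^ n) f g \<Longrightarrow> (move ^^ n) (f \<circ> \<pi>) (g \<circ> \<pi>)"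
proof (induction n arbitrary: g)
  case (Suc n)
  then obtain h where "(move ^^ n) f h" "move h g" by (auto elim: relpowp_Suc_E)
  then show ?case using Suc.IH move_comp[OF _ assms] by (blast intro: relpowp_Suc_I)
qed simp

lemma moves_refl: "labelling f \<Longrightarrow> (move ^^ n) f f"
  by (induction n) (auto intro: relpowp_Suc_I move_refl simp del: relpowp.simps(2))

lemma moves_mono:
  assumes "labelling f" and "m \<le> n" and "(move ^^ m) f g"
  shows "(move ^^ n) f g"
proof -
  have "(move ^^ ((n - m) + m)) f g"
    unfolding relpowp_add using moves_refl[OF assms(1)] assms(3) by blast
  then show ?thesis using assms(2) by simp
qed

lemma rotation_permutes:
  assumes "r < k"
  shows "(\<lambda>i. if i < k then (i + k - r) mod k else i) permutes {..<k}" (is "?\<rho> permutes _")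
proof (rule bij_imp_permutes)
  have "inj_on ?\<rho> {..<k}"
  proof (rule inj_onI)
    fix i j assume ij: "i \<in> {..<k}" "j \<in> {..<k}" "?\<rho> i = ?\<rho> j"
    have "((i + k - r) mod k + r) mod k = i" if "i < k" for i
    proof -
      have "((i + k - r) mod k + r) mod k = (i + k - r + r) mod k" by (simp add: mod_add_left_eq)
      also have "\<dots> = i" using assms that by simp
      finally show ?thesis .
    qed
    then show "i = j" using ij by (metis lessThan_iff)
  qed
  moreover have "?\<rho> ` {..<k} \<subseteq> {..<k}" using k_ge_3 by auto
  ultimately show "bij_betw ?\<rho> {..<k} {..<k}"
    unfolding bij_betw_def using endo_inj_surj by blast
qed auto

lemma window_slot:
  assumes "i < k"
  shows "(t + i) mod k = (if t mod k + i < k then t mod k + i else t mod k + i - k)"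
    and "(t + i) div k = (if t mod k + i < k then t div k else Suc (t div k))"
proof -
  define r where "r = t mod k"
  have r: "r < k" using k_ge_3 by (simp add: r_def)
  have t: "t + i = (r + i) + (t div k) * k" by (simp add: r_def)
  have "(r + i) mod k = (if r + i < k then r + i else r + i - k)"
    "(r + i) div k = (if r + i < k then 0 else 1)"
    using r assms by (auto simp: le_mod_geq le_div_geq)
  then show "(t + i) mod k = (if t mod k + i < k then t mod k + i else t mod k + i - k)"
    and "(t + i) div k = (if t mod k + i < k then t div k else Suc (t div k))"
    unfolding t using k_ge_3 by (simp_all only: mod_mult_self1 div_mult_self1 r_def) auto
qed

lemma window_slots: "(\<lambda>i. (t + i) mod k) ` {..<k} = {..<k}"
proof (rule endo_inj_surj)
  have "t mod k < k" using k_ge_3 by simp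
  then show "inj_on (\<lambda>i. (t + i) mod k) {..<k}"
    by (intro inj_onI) (auto simp: window_slot split: if_splits)
qed (use k_ge_3 in auto)

text \<open>If \<open>m = l div k\<close> moves lead from a labelled edge to the same edge with its slots rotated by
  \<open>l mod k\<close>, then performing one move in each round through the slots gives a closed tight walk of
  length \<open>l\<close>.\<close>

lemma hom_copy_if_rotation:
  assumes "k < l"
    and moves: "(move ^^ (l div k)) f
      (f \<circ> (\<lambda>i. if i < k then (i + k - l mod k) mod k else i))" (is "(move ^^ ?m) f (f \<circ> ?\<rho>)")
  shows "contains_hom_copy V E (tight_cycle_verts l) (tight_cycle_edges k l)"
proof -
  obtain F where F0: "F 0 = f" and Fm: "F ?m = f \<circ> ?\<rho>"
    and step: "\<And>c. c < ?m \<Longrightarrow> move (F c) (F (Suc c))"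
    using moves by (auto simp: relpowp_fun_conv)
  define G where "G c = F (min c ?m)" for c
  have "?m > 0" using assms(1) k_ge_3 by (simp add: div_greater_zero_iff)
  have "labelling (F ?m)"
    using step[of "?m - 1"] \<open>?m > 0\<close> by (simp add: move_def)
  then have G_move: "move (G c) (G (Suc c))" for c
    using step[of c] by (cases "c < ?m") (auto simp: G_def min_def move_refl Suc_le_eq)
  define v where "v t = G (t div k) (t mod k)" for t
  have window: "(\<lambda>i. v (t + i)) ` {..<k} \<in> E" for t
  proof -
    define c where "c = t div k"
    obtain a w where aw: "a < k" "G (Suc c) = (G c)(a := w)" "labelling (G c)" "labelling (G (Suc c))"
      using G_move[of c] by (auto simp: move_def)
    define h where "h = (if a < t mod k then G (Suc c) else G c)"
    have "t mod k < k" using k_ge_3 by simp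
    then have "v (t + i) = h ((t + i) mod k)" if "i < k" for i
      using that aw by (auto simp: v_def h_def window_slot c_def)
    then have "(\<lambda>i. v (t + i)) ` {..<k} = h ` (\<lambda>i. (t + i) mod k) ` {..<k}"
      by (auto simp: image_image)
    also have "\<dots> = h ` {..<k}" by (simp add: window_slots)
    finally show ?thesis using aw by (auto simp: h_def labelling_def)
  qed
  have periodic: "v (l + j) = v j" if "j < k" for j
  proof -
    have "min ((l + j) div k) ?m = ?m" by (simp add: div_le_mono)
    then have "v (l + j) = f (?\<rho> ((l + j) mod k))"
      by (simp only: v_def G_def Fm comp_apply)
    also have "?\<rho> ((l + j) mod k) = j"
    proof -
      define r where "r = l mod k"
      have r: "r < k" using k_ge_3 by (simp add: r_def)
      have "(l + j) mod k = (r + j) mod k" by (simp add: r_def mod_add_left_eq)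
      then have "?\<rho> ((l + j) mod k) = ((r + j) mod k + (k - r)) mod k"
        using r k_ge_3 by (simp add: r_def)
      also have "\<dots> = (r + j + (k - r)) mod k" by (simp add: mod_add_left_eq)
      also have "r + j + (k - r) = j + k" using r by simp
      finally show ?thesis using that by simp
    qed
    finally show ?thesis using that by (simp add: v_def G_def F0)
  qed
  show ?thesis
    unfolding contains_hom_copy_def
  proof (intro exI[of _ v] conjI ballI)
    show "v ` tight_cycle_verts l \<subseteq> V"
    proof -
      have "v t \<in> V" for t
        using edge_sub[OF window[of t]] k_ge_3 by (auto simp: image_subset_iff dest!: bspec[of _ _ 0])
      then show ?thesis by blast
    qed
  next
    fix e assume "e \<in> tight_cycle_edges k l"
    then obtain i where "i < l" and e: "e = (\<lambda>j. (i + j) mod l) ` {..<k}"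
      by (auto simp: tight_cycle_edges_def)
    have "v ((i + j) mod l) = v (i + j)" if "j < k" for j
    proof (cases "i + j < l")
      case False
      then have "(i + j) mod l = i + j - l" "i + j - l < k"
        using \<open>i < l\<close> that assms(1) by (auto simp: le_mod_geq)
      then show ?thesis using periodic[of "i + j - l"] False by simp
    qed simp
    then have "v ` e = (\<lambda>j. v (i + j)) ` {..<k}" by (auto simp: e image_image)
    then show "v ` e \<in> E" using window by simp
  qed
qed

end
section \<open>Permuting the slots of an edge\<close>

locale tight_cycle_free = dense_hypergraph +
  fixes l :: nat
  assumes long: "20 * k ^ 2 \<le> l"
    and free: "\<not> contains_hom_copy V E (tight_cycle_verts l) (tight_cycle_edges k l)"
begin

definition reaches :: "(nat \<Rightarrow> 'a) \<Rightarrow> nat \<Rightarrow> (nat \<Rightarrow> nat) \<Rightarrow> bool" where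
  "reaches f n \<pi> \<longleftrightarrow> \<pi> permutes {..<k} \<and> (move ^^ n) f (f \<circ> \<pi>)"

abbreviation swaps :: "(nat \<Rightarrow> 'a) \<Rightarrow> nat \<Rightarrow> nat \<Rightarrow> nat \<Rightarrow> bool" where
  "swaps f n a b \<equiv> reaches f n (transpose a b)"

lemma reaches_mono: "labelling f \<Longrightarrow> reaches f m \<pi> \<Longrightarrow> m \<le> n \<Longrightarrow> reaches f n \<pi>"
  using moves_mono by (auto simp: reaches_def)

lemma reaches_id: "labelling f \<Longrightarrow> reaches f n id"
  by (simp add: reaches_def moves_refl permutes_id)

text \<open>A sequence of moves from \<open>f\<close> can be replayed from any relabelling of \<open>f\<close>, so the
  permutations that are realised by closed sequences of moves form a group, with additive cost.\<close>

lemma reaches_comp: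
  assumes "reaches f n \<pi>" and "reaches f m \<rho>"
  shows "reaches f (n + m) (\<rho> \<circ> \<pi>)"
proof -
  have "(move ^^ m) (f \<circ> \<pi>) (f \<circ> \<rho> \<circ> \<pi>)"
    using assms by (intro moves_comp) (auto simp: reaches_def)
  then have "(move ^^ (n + m)) f (f \<circ> (\<rho> \<circ> \<pi>))"
    using assms(1) unfolding relpowp_add by (auto simp: reaches_def comp_assoc)
  then show ?thesis using assms by (auto simp: reaches_def intro: permutes_compose)
qed

lemma swaps_sym: "swaps f n a b \<Longrightarrow> swaps f n b a"
  by (simp add: transpose_commute)

lemma swaps_trans:
  assumes "labelling f" and "swaps f n a b" and "swaps f m b c"
  shows "swaps f (2 * n + m) a c"
proof (cases "a = c \<or> b = c")
  case True
  then show ?thesis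
    using reaches_mono[OF assms(1,2), of "2 * n + m"] reaches_id[OF assms(1)] by auto
next
  case False
  have "reaches f (n + m + n) (transpose a b \<circ> (transpose b c \<circ> transpose a b))"
    by (intro reaches_comp assms)
  then show ?thesis
    using False transpose_comp_triple[of a c b] by (simp add: comp_assoc mult_2 add.commute add.left_commute)
qed

lemma reaches_if_swaps:
  assumes f: "labelling f" and sw: "\<And>a b. a < k \<Longrightarrow> b < k \<Longrightarrow> swaps f c a b"
    and "finite S" and "S \<subseteq> {..<k}" and "\<pi> permutes S"
  shows "reaches f (c * card S) \<pi>"
  using assms(3-5)
proof (induction S arbitrary: \<pi>)
  case empty
  then have "\<pi> = id" by simp
  show ?case unfolding \<open>\<pi> = id\<close> by (rule reaches_id[OF f])
next
  case (insert x S)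
  define \<rho> where "\<rho> = transpose x (\<pi> x) \<circ> \<pi>"
  have "reaches f (c * card S) \<rho>"
    using insert permutes_insert_lemma[OF insert.prems(2)] by (simp add: \<rho>_def)
  moreover have "\<pi> x < k"
    using insert.prems permutes_in_image[OF insert.prems(2), of x] by auto
  then have "swaps f c x (\<pi> x)" using insert.prems by (intro sw) auto
  ultimately have "reaches f (c * card S + c) (transpose x (\<pi> x) \<circ> \<rho>)"
    by (rule reaches_comp)
  moreover have "transpose x (\<pi> x) \<circ> \<rho> = \<pi>"
    by (simp add: \<rho>_def fun_eq_iff)
  ultimately show ?case using insert.hyps by (simp add: algebra_simps)
qed

text \<open>Every permutation of the slots is a product of at most \<open>k\<close> transpositions. If each of these takes at
  most 17 moves, then the rotation needed for a closed walk of length \<open>l\<close> takes at most \<open>17 k\<close>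
  moves, and there are \<open>l div k \<ge> 20 k\<close> rounds to perform them.\<close>

lemma not_all_swaps:
  assumes f: "labelling f" and sw: "\<And>a b. a < k \<Longrightarrow> b < k \<Longrightarrow> swaps f 17 a b"
  shows False
proof -
  let ?\<rho> = "\<lambda>i. if i < k then (i + k - l mod k) mod k else i"
  have "?\<rho> permutes {..<k}" using rotation_permutes k_ge_3 by simp
  then have "reaches f (17 * card {..<k}) ?\<rho>"
    by (intro reaches_if_swaps f sw) auto
  moreover have "20 * k \<le> l div k"
    using div_le_mono[OF long, of k] k_ge_3 by (simp add: power2_eq_square)
  ultimately have "reaches f (l div k) ?\<rho>"
    by (elim reaches_mono[OF f]) simp
  moreover have "k < l"
  proof -
    have "k * 1 < k * (20 * k)" using k_ge_3 by (intro mult_strict_left_mono) auto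
    moreover have "k * (20 * k) = 20 * k ^ 2" by (simp add: power2_eq_square)
    ultimately show ?thesis using long by linarith
  qed
  ultimately show False
    using hom_copy_if_rotation free by (auto simp: reaches_def)
qed

section \<open>The two classes of an edge\<close>

text \<open>If some \<open>w\<close> can replace either of two vertices of an edge, then these two can be swapped with
  three moves, using \<open>w\<close> as temporary storage.\<close>

definition adj :: "'a set \<Rightarrow> 'a \<Rightarrow> 'a \<Rightarrow> bool" where
  "adj e x y \<longleftrightarrow> (\<exists>w. insert w (e - {x}) \<in> E \<and> insert w (e - {y}) \<in> E)"

lemma adj_refl: "e \<in> E \<Longrightarrow> x \<in> e \<Longrightarrow> adj e x x"
  unfolding adj_def by (auto intro!: exI[of _ x] simp: insert_absorb)

lemma adj_sym: "adj e x y \<Longrightarrow> adj e y x"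
  unfolding adj_def by blast

lemma adj_two_of_three:
  assumes "e \<in> E" and "x \<in> e" "y \<in> e" "z \<in> e"
  shows "adj e x y \<or> adj e x z \<or> adj e y z"
  using two_of_three_meet[of "e - {x}" "e - {y}" "e - {z}"]
    edge_minus_vertex[OF assms(1)] assms(2-4)
  unfolding adj_def nbh_def by blast

lemma image_fun_upd:
  assumes "labelling f" and "a < k"
  shows "f(a := w) ` {..<k} = insert w (f ` {..<k} - {f a})"
  using inj_onD[OF labelling_inj[OF assms(1)]] assms(2) by (auto simp: image_iff)

lemma swaps_if_adj:
  assumes f: "labelling f" and a: "a < k" and b: "b < k"
    and "adj (f ` {..<k}) (f a) (f b)"
  shows "swaps f 3 a b"
proof (cases "a = b")
  case True
  then show ?thesis using reaches_id[OF f] by simp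
next
  case False
  obtain w where w: "labelling (f(a := w))" "labelling (f(b := w))"
    using assms(4) image_fun_upd[OF f a] image_fun_upd[OF f b]
    unfolding adj_def labelling_def by metis
  have \<tau>: "transpose a b permutes {..<k}" using a b by (simp add: permutes_swap_id)
  have "f(b := w) \<circ> transpose a b = f(a := w, b := f a)"
    using False by (auto simp: fun_eq_iff transpose_def)
  then have w': "labelling (f(a := w, b := f a))"
    using labelling_comp[OF w(2) \<tau>] by simp
  have \<tau>_eq: "f \<circ> transpose a b = f(a := w, b := f a, a := f b)"
    using False by (auto simp: fun_eq_iff transpose_def)
  have "move f (f(a := w))" "move (f(a := w)) (f(a := w, b := f a))"
    using f w w' a b by (auto simp: move_def)
  moreover have "move (f(a := w, b := f a)) (f \<circ> transpose a b)"
    unfolding move_def using labelling_comp[OF f \<tau>] w' a \<tau>_eq by blast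
  ultimately have "(move ^^ 3) f (f \<circ> transpose a b)"
    by (auto simp: numeral_3_eq_3)
  then show ?thesis using \<tau> by (simp add: reaches_def)
qed

lemma swaps_after_move:
  assumes "move f g" and "swaps g n a b"
  shows "swaps f (n + 2) a b"
proof -
  have "(move ^^ Suc n) f (g \<circ> transpose a b)"
    using assms relpowp_Suc_I2 by (auto simp: reaches_def)
  moreover have "move (g \<circ> transpose a b) (f \<circ> transpose a b)"
    using assms(2) move_comp[OF move_sym[OF assms(1)]] by (auto simp: reaches_def)
  ultimately show ?thesis
    using assms(2) relpowp_Suc_I by (fastforce simp: reaches_def)
qed

text \<open>Among any three vertices of an edge two are adjacent. If \<open>b\<close> is adjacent to the non-adjacent
  vertices \<open>a\<close> and \<open>c\<close>, then any two vertices are joined by a path of at most three adjacencies: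
  vertices near \<open>a\<close> and near \<open>c\<close> that are not adjacent cannot both be non-adjacent to \<open>b\<close>. Hence
  each transposition takes at most \<open>2 \<cdot> 3 + (2 \<cdot> 3 + 3) = 15\<close> moves.\<close>

lemma slot_adj_trans:
  assumes f: "labelling f" and k: "a < k" "b < k" "c < k"
    and ab: "adj (f ` {..<k}) (f a) (f b)" and bc: "adj (f ` {..<k}) (f b) (f c)"
  shows "adj (f ` {..<k}) (f a) (f c)"
proof (rule ccontr)
  let ?A = "\<lambda>x y. adj (f ` {..<k}) (f x) (f y)"
  assume ac: "\<not> ?A a c"
  have e: "f ` {..<k} \<in> E" using f by (simp add: labelling_def)
  have three: "?A x y \<or> ?A x z \<or> ?A y z" if "x < k" "y < k" "z < k" for x y z
    using adj_two_of_three[OF e] that by simp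
  have refl: "?A x x" if "x < k" for x using adj_refl[OF e] that by simp
  have sym: "?A y x" if "?A x y" for x y using adj_sym that by simp
  have path: "\<exists>p<k. \<exists>q<k. ?A x p \<and> ?A p q \<and> ?A q y" if x: "x < k" and y: "y < k" for x y
  proof -
    have "?A x a \<or> ?A x c" "?A y a \<or> ?A y c" using three ac k x y sym by meson+
    moreover have "?A x b \<or> ?A b y \<or> ?A x y" using three[OF x k(2) y] by blast
    ultimately show ?thesis
      using k x y refl sym ab bc by meson
  qed
  have "swaps f 17 x y" if x: "x < k" and y: "y < k" for x y
  proof -
    obtain p q where "p < k" "q < k" "?A x p" "?A p q" "?A q y" using path[OF x y] by blast
    then have "swaps f 3 x p" "swaps f 3 p q" "swaps f 3 q y"
      using swaps_if_adj[OF f] x y by auto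
    then have "swaps f (2 * 3 + (2 * 3 + 3)) x y" by (blast intro: swaps_trans f)
    then show ?thesis by (rule reaches_mono[OF f]) simp
  qed
  then show False using not_all_swaps f by blast
qed

text \<open>Adjacency therefore has two cliques as classes. One further transposition \<open>(u v)\<close> across the
  classes that takes five moves would give all the others: \<open>(x y) = (x u)(u y)(x u)\<close> where
  \<open>(u y) = (y v)(v u)(y v)\<close>, which takes \<open>2 \<cdot> 3 + (2 \<cdot> 3 + 5) = 17\<close> moves.\<close>

lemma slot_adj_if_swaps:
  assumes f: "labelling f" and u: "u < k" and v: "v < k" and uv: "swaps f 5 u v"
  shows "adj (f ` {..<k}) (f u) (f v)"
proof (rule ccontr)
  let ?A = "\<lambda>x y. adj (f ` {..<k}) (f x) (f y)"
  assume nuv: "\<not> ?A u v"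
  have e: "f ` {..<k} \<in> E" using f by (simp add: labelling_def)
  have sym: "?A y x" if "?A x y" for x y using adj_sym that by simp
  have near: "?A x u \<or> ?A x v" if "x < k" for x
    using adj_two_of_three[OF e, of "f x" "f u" "f v"] that u v nuv by auto
  have far: "swaps f 17 x y" if "x < k" "y < k" "?A x u" "?A y v" "swaps f 5 u v" "u < k" "v < k"
    for x y u v
  proof -
    have "swaps f 3 x u" "swaps f 3 y v" using that swaps_if_adj[OF f] by auto
    then have "swaps f (2 * 3 + 5) y u" using that by (blast intro: swaps_trans f swaps_sym)
    then have "swaps f (2 * 3 + (2 * 3 + 5)) x y"
      using \<open>swaps f 3 x u\<close> by (blast intro: swaps_trans f swaps_sym)
    then show ?thesis by simp
  qed
  have "swaps f 17 x y" if x: "x < k" and y: "y < k" for x y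
  proof (cases "?A x y")
    case True
    then show ?thesis using reaches_mono[OF f swaps_if_adj[OF f x y]] by simp
  next
    case False
    then have "?A x u \<and> ?A y v \<or> ?A x v \<and> ?A y u"
      using near[OF x] near[OF y] slot_adj_trans[OF f] sym x y u v by meson
    then show ?thesis
      using far[OF x y _ _ uv u v] far[OF x y _ _ swaps_sym[OF uv] v u] by blast
  qed
  then show False using not_all_swaps f by blast
qed

lemma adj_trans:
  assumes "e \<in> E" and "x \<in> e" "y \<in> e" "z \<in> e" and "adj e x y" "adj e y z"
  shows "adj e x z"
proof -
  obtain f where "labelling f" "f ` {..<k} = e" using labelling_exists[OF assms(1)] .
  with slot_adj_trans[of f] assms show ?thesis by blast
qed

lemma not_all_adj:
  assumes "e \<in> E"
  shows "\<exists>x\<in>e. \<exists>y\<in>e. \<not> adj e x y"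
proof (rule ccontr)
  assume all: "\<not> ?thesis"
  obtain f where f: "labelling f" "f ` {..<k} = e" using labelling_exists[OF assms] .
  have "swaps f 17 a b" if "a < k" "b < k" for a b
    using reaches_mono[OF f(1) swaps_if_adj[OF f(1) that]] all f(2) that by auto
  then show False using not_all_swaps f by blast
qed

text \<open>The class structure is attached to the slots, not to the vertices: if a swap is available after
  a move, then perform the move, swap, and undo the move. In particular a vertex that replaces
  \<open>y\<close> inherits the class of \<open>y\<close>.\<close>

lemma adj_before_move:
  assumes y: "insert y S \<in> E" "y \<notin> S" and w: "insert w S \<in> E" "w \<notin> S"
    and "p \<in> insert w S" "q \<in> insert w S"
    and adj: "adj (insert w S) p q"
  shows "adj (insert y S) (if p = w then y else p) (if q = w then y else q)"
proof -
  obtain f where f: "labelling f" "f ` {..<k} = insert y S" using labelling_exists[OF y(1)] .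
  obtain a where a: "a < k" "f a = y" using f(2) by (metis imageE insertI1 lessThan_iff)
  have img: "f(a := w) ` {..<k} = insert w S"
    using image_fun_upd[OF f(1) a(1), of w] f(2) a(2) y(2) by simp
  then have g: "labelling (f(a := w))" using w by (simp add: labelling_def del: fun_upd_apply)
  obtain i j where ij: "i < k" "j < k" "p = (f(a := w)) i" "q = (f(a := w)) j"
    using assms(5,6) unfolding img[symmetric] by (auto simp del: fun_upd_apply)
  have "swaps (f(a := w)) 3 i j"
    using swaps_if_adj[OF g ij(1,2)] adj img ij by (simp del: fun_upd_apply)
  moreover have "move f (f(a := w))" using f g a by (auto simp: move_def)
  ultimately have "swaps f (3 + 2) i j" by (rule swaps_after_move[rotated])
  then have "adj (insert y S) (f i) (f j)"
    using slot_adj_if_swaps[OF f(1) ij(1,2)] f(2) by simp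
  moreover have "f x = (if (f(a := w)) x = w then y else (f(a := w)) x)" if "x < k" for x
    using that w(2) a f(2) by (metis (no_types, lifting) fun_upd_apply imageI insertE lessThan_iff)
  then have "f i = (if p = w then y else p)" "f j = (if q = w then y else q)"
    using ij by blast+
  ultimately show ?thesis by metis
qed

lemma adj_exchange:
  assumes y: "insert y S \<in> E" "y \<notin> S" and w: "insert w S \<in> E" "w \<notin> S"
  shows "u \<in> S \<Longrightarrow> v \<in> S \<Longrightarrow> adj (insert y S) u v \<longleftrightarrow> adj (insert w S) u v"
    and "z \<in> S \<Longrightarrow> adj (insert y S) y z \<longleftrightarrow> adj (insert w S) w z"
proof -
  show "adj (insert y S) u v \<longleftrightarrow> adj (insert w S) u v" if "u \<in> S" "v \<in> S"
  proof -
    have "u \<noteq> w" "v \<noteq> w" "u \<noteq> y" "v \<noteq> y" using that y w by auto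
    then show ?thesis
      using adj_before_move[OF y w, of u v] adj_before_move[OF w y, of u v] that by auto
  qed
  show "adj (insert y S) y z \<longleftrightarrow> adj (insert w S) w z" if "z \<in> S"
  proof -
    have "z \<noteq> w" "z \<noteq> y" using that y w by auto
    then show ?thesis
      using adj_before_move[OF y w, of w z] adj_before_move[OF w y, of y z] that by auto
  qed
qed

text \<open>For non-adjacent \<open>a\<close> and \<open>b\<close>, each vertex of the edge is adjacent to exactly one of them, so
  adjacency to \<open>a\<close> can serve as the indicator \<open>s\<close> of a class.\<close>

lemma edge_classes:
  assumes "e \<in> E"
  obtains s :: "'a \<Rightarrow> bool"
  where "\<forall>x\<in>e. \<forall>y\<in>e. adj e x y \<longleftrightarrow> s x = s y"
    and "\<exists>x\<in>e. \<exists>y\<in>e. s x \<noteq> s y"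
proof -
  obtain a b where ab: "a \<in> e" "b \<in> e" "\<not> adj e a b" using not_all_adj[OF assms] by blast
  have "adj e x y \<longleftrightarrow> adj e a x = adj e a y" if "x \<in> e" "y \<in> e" for x y
    using adj_two_of_three[OF assms, of a x y] adj_trans[OF assms] adj_sym that ab by meson
  moreover have "\<exists>x\<in>e. \<exists>y\<in>e. adj e a x \<noteq> adj e a y"
    using ab adj_refl[OF assms] by blast
  ultimately show thesis using that[of "adj e a"] by blast
qed

end
context tight_cycle_free
begin

section \<open>Crossing sets\<close>

text \<open>The family of crossing \<open>(k-2)\<close>-sets records the classes of all edges at once: whether the two
  vertices that complete \<open>T\<close> to an edge come from different classes depends on \<open>T\<close> only, as
  \<open>crossing_iff\<close> shows.\<close>

definition crossing :: "'a set \<Rightarrow> bool" where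
  "crossing T \<longleftrightarrow> (\<exists>x y. x \<notin> T \<and> y \<notin> T \<and> x \<noteq> y \<and> insert x (insert y T) \<in> E
     \<and> \<not> adj (insert x (insert y T)) x y)"

lemma card_link:
  assumes "insert x (insert y T) \<in> E" "x \<notin> T" "y \<notin> T" "x \<noteq> y"
  shows "T \<subseteq> V" "card T = k - 2" "x \<in> V" "y \<in> V" "finite T"
proof -
  show sub: "T \<subseteq> V" "x \<in> V" "y \<in> V" using edge_sub[OF assms(1)] by auto
  show "finite T" using sub fin_V finite_subset by blast
  then show "card T = k - 2" using edge_card[OF assms(1)] assms(2-4) by simp
qed

lemma card_insert_link:
  assumes "T \<subseteq> V" "card T = k - 2" "x \<in> V" "x \<notin> T"
  shows "insert x T \<subseteq> V" "card (insert x T) = k - 1"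
  using assms k_ge_3 finite_subset[OF assms(1) fin_V] by auto

lemma link_exchange:
  assumes ab: "insert a (insert b T) \<in> E" and az: "insert a (insert z T) \<in> E"
    and "a \<notin> T" "b \<notin> T" "z \<notin> T" "a \<noteq> b" "a \<noteq> z"
  shows "adj (insert a (insert b T)) a b \<longleftrightarrow> adj (insert a (insert z T)) a z"
    and "u \<in> T \<Longrightarrow> v \<in> T \<Longrightarrow>
      adj (insert a (insert b T)) u v \<longleftrightarrow> adj (insert a (insert z T)) u v"
proof -
  have *: "insert b (insert a T) \<in> E" "b \<notin> insert a T" "insert z (insert a T) \<in> E" "z \<notin> insert a T"
    using assms by (auto simp: insert_commute)
  show "adj (insert a (insert b T)) a b \<longleftrightarrow> adj (insert a (insert z T)) a z"
    using adj_exchange(2)[OF *, of a] adj_sym by (auto simp: insert_commute)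
  show "adj (insert a (insert b T)) u v \<longleftrightarrow> adj (insert a (insert z T)) u v" if "u \<in> T" "v \<in> T"
    using adj_exchange(1)[OF *, of u v] that by (simp add: insert_commute)
qed

text \<open>If \<open>x\<close> and \<open>y\<close> are not adjacent in the edge \<open>T + x + y\<close>, then the neighbourhoods of \<open>T + x\<close>
  and \<open>T + y\<close> are disjoint, so the neighbourhood of any \<open>T + x'\<close> meets one of the two. Hence the
  link graph of \<open>T\<close> is connected, with a short path between any two of its edges.\<close>

lemma crossing_link:
  assumes xy: "insert x (insert y T) \<in> E" "x \<notin> T" "y \<notin> T" "x \<noteq> y"
    and nadj: "\<not> adj (insert x (insert y T)) x y"
    and xy': "insert x' (insert y' T) \<in> E" "x' \<notin> T" "y' \<notin> T" "x' \<noteq> y'"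
  shows "\<not> adj (insert x' (insert y' T)) x' y'"
    and "u \<in> T \<Longrightarrow> v \<in> T \<Longrightarrow>
      adj (insert x (insert y T)) u v \<longleftrightarrow> adj (insert x' (insert y' T)) u v"
proof -
  note T = card_link[OF xy] card_link(3,4)[OF xy']
  have diff: "insert x (insert y T) - {x} = insert y T" "insert x (insert y T) - {y} = insert x T"
    using xy by auto
  have "N (insert y T) \<inter> N (insert x T) = {}"
    using nadj unfolding adj_def diff nbh_def by blast
  moreover have "N (insert x T) \<inter> N (insert y T) \<noteq> {} \<or> N (insert x T) \<inter> N (insert x' T) \<noteq> {}
      \<or> N (insert y T) \<inter> N (insert x' T) \<noteq> {}"
    using card_insert_link[OF T(1,2)] T xy xy' by (intro two_of_three_meet) auto
  ultimately obtain a z where a: "a = x \<or> a = y" and z: "z \<in> N (insert a T)" "z \<in> N (insert x' T)"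
    by blast
  obtain b where ab: "{a, b} = {x, y}" using a by blast
  have abT: "a \<notin> T" "b \<notin> T" "a \<noteq> b" "insert a (insert b T) = insert x (insert y T)" "a \<in> V"
    using ab xy T by (auto simp: doubleton_eq_iff)
  have zT: "z \<notin> T" "a \<noteq> z" "x' \<noteq> z"
    using N_not_mem[OF _ z(1)] N_not_mem[OF _ z(2)] card_insert_link(2)[OF T(1,2)] abT xy' T by auto
  have E: "insert a (insert b T) \<in> E" "insert a (insert z T) \<in> E" "insert z (insert a T) \<in> E"
    "insert z (insert x' T) \<in> E" "insert x' (insert z T) \<in> E"
    using abT xy z by (auto simp: nbh_def insert_commute)
  note 1 = link_exchange[OF E(1,2) abT(1,2) zT(1) abT(3) zT(2)]
  note 2 = link_exchange[OF E(3,4) zT(1) abT(1) xy'(2) zT(2,3)[symmetric]]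
  note 3 = link_exchange[OF E(5) xy'(1,2) zT(1) xy'(3) zT(3) xy'(4)]
  have "\<not> adj (insert a (insert b T)) a b"
    using nadj ab abT(4) adj_sym by (auto simp: doubleton_eq_iff)
  then show "\<not> adj (insert x' (insert y' T)) x' y'"
    using 1(1) 2(1) 3(1) adj_sym by (metis insert_commute)
  show "adj (insert x (insert y T)) u v \<longleftrightarrow> adj (insert x' (insert y' T)) u v"
    if "u \<in> T" "v \<in> T"
    using 1(2)[OF that] 2(2)[OF that] 3(2)[OF that] abT(4) by (simp add: insert_commute)
qed

lemma crossing_iff:
  assumes "insert x (insert y T) \<in> E" "x \<notin> T" "y \<notin> T" "x \<noteq> y"
  shows "crossing T \<longleftrightarrow> \<not> adj (insert x (insert y T)) x y"
  using assms crossing_link(1) unfolding crossing_def by meson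

lemma edge_sides:
  assumes "e \<in> E"
  obtains s :: "'a \<Rightarrow> bool"
  where "\<forall>x\<in>e. \<forall>y\<in>e. x \<noteq> y \<longrightarrow> (crossing (e - {x, y}) \<longleftrightarrow> s x \<noteq> s y)"
    and "\<exists>x\<in>e. \<exists>y\<in>e. s x \<noteq> s y"
proof -
  obtain s :: "'a \<Rightarrow> bool" where s[rule_format]: "\<forall>x\<in>e. \<forall>y\<in>e. adj e x y \<longleftrightarrow> s x = s y"
    and ne: "\<exists>x\<in>e. \<exists>y\<in>e. s x \<noteq> s y"
    using edge_classes[OF assms] .
  have "crossing (e - {x, y}) \<longleftrightarrow> s x \<noteq> s y" if "x \<in> e" "y \<in> e" "x \<noteq> y" for x y
  proof -
    have "insert x (insert y (e - {x, y})) = e" using that by auto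
    then show ?thesis using crossing_iff[of x y "e - {x, y}"] s[of x y] assms that by simp
  qed
  then show thesis using ne that by blast
qed

lemma link_extend:
  assumes "T \<subseteq> V" "card T = k - 2" "x \<in> V" "x \<notin> T"
  obtains y where "insert x (insert y T) \<in> E" "y \<notin> T" "y \<noteq> x" "y \<in> V"
proof -
  note c = card_insert_link[OF assms]
  obtain y where y: "y \<in> N (insert x T)" using N_nonempty[OF c] by blast
  then have "y \<notin> insert x T" using N_not_mem[OF c(2)] by blast
  then show thesis using y that by (auto simp: nbh_def insert_commute)
qed

text \<open>For a \<open>(k-4)\<close>-set \<open>R\<close>, colour the pairs \<open>ab\<close> according to whether \<open>R + a + b\<close> is crossing. The
  goal of this section is that every 4-cycle in this colouring is even, as it should be if membership
  in the crossing family is the parity of the intersection with a fixed vertex set. The easy case is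
  that one diagonal \<open>p q\<close> of the 4-cycle \<open>a p a' q\<close> is crossing: both paths \<open>p a q\<close> and \<open>p a' q\<close>
  tell whether \<open>p\<close> and \<open>q\<close> are in the same class, and the link of \<open>R + p + q\<close> is connected.\<close>

lemma four_cycle_if_crossing:
  assumes cr: "crossing (insert p (insert q R))" and pq: "p \<notin> R" "q \<notin> R" "p \<noteq> q"
    and a: "a \<in> V" "a \<notin> insert p (insert q R)" and a': "a' \<in> V" "a' \<notin> insert p (insert q R)"
  shows "(crossing (insert a (insert p R)) = crossing (insert a (insert q R)))
     = (crossing (insert a' (insert p R)) = crossing (insert a' (insert q R)))"
proof -
  let ?T = "insert p (insert q R)"
  obtain x y where xy: "x \<notin> ?T" "y \<notin> ?T" "x \<noteq> y" "insert x (insert y ?T) \<in> E"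
    "\<not> adj (insert x (insert y ?T)) x y"
    using cr unfolding crossing_def by blast
  have "(crossing (insert a (insert p R)) = crossing (insert a (insert q R)))
      \<longleftrightarrow> adj (insert x (insert y ?T)) p q"
    if a: "a \<in> V" "a \<notin> ?T" for a
  proof -
    obtain b where b: "insert a (insert b ?T) \<in> E" "b \<notin> ?T" "b \<noteq> a"
      using link_extend[OF card_link(1,2)[OF xy(4,1,2,3)] a] by blast
    define e where "e = insert a (insert b ?T)"
    have "e \<in> E" using b(1) by (simp add: e_def)
    obtain s :: "'a \<Rightarrow> bool"
      where s[rule_format]: "\<forall>x\<in>e. \<forall>y\<in>e. x \<noteq> y \<longrightarrow> (crossing (e - {x, y}) \<longleftrightarrow> s x \<noteq> s y)"
        and "\<exists>x\<in>e. \<exists>y\<in>e. s x \<noteq> s y"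
      using edge_sides[OF \<open>e \<in> E\<close>] .
    have "e - {q, b} = insert a (insert p R)" "e - {p, b} = insert a (insert q R)"
      using a b pq by (auto simp: e_def)
    then have "crossing (insert a (insert p R)) \<longleftrightarrow> s q \<noteq> s b"
      "crossing (insert a (insert q R)) \<longleftrightarrow> s p \<noteq> s b"
      using s[of q b] s[of p b] a b by (auto simp: e_def)
    moreover have "crossing (e - {p, q}) \<longleftrightarrow> \<not> adj e p q"
    proof -
      have "insert p (insert q (e - {p, q})) = e" by (auto simp: e_def)
      then show ?thesis using crossing_iff[of p q "e - {p, q}"] b(1) pq by (simp add: e_def)
    qed
    moreover have "crossing (e - {p, q}) \<longleftrightarrow> s p \<noteq> s q" using s pq by (simp add: e_def)
    moreover have "adj (insert x (insert y ?T)) p q \<longleftrightarrow> adj e p q"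
      unfolding e_def using crossing_link(2)[OF xy(4,1,2,3,5) b(1) a(2) b(2) b(3)[symmetric]] by blast
    ultimately show ?thesis by blast
  qed
  from this[OF a] this[OF a'] show ?thesis by simp
qed

text \<open>The other diagonals \<open>u v\<close> are those where \<open>T = R + u + v\<close> is not crossing. Then the link of
  \<open>T\<close> may have two components. The signature of \<open>x\<close> tells which vertices of \<open>T\<close> are not in the class
  of \<open>x\<close>, in any edge that contains \<open>T + x\<close>.\<close>

definition signature :: "'a set \<Rightarrow> 'a \<Rightarrow> 'a set" where
  "signature T x = {r \<in> T. crossing (insert x (T - {r}))}"

lemma signature_edge:
  assumes nc: "\<not> crossing T" and e: "insert x (insert y T) \<in> E" "x \<notin> T" "y \<notin> T" "x \<noteq> y"
  shows "signature T x = signature T y" and "signature T x \<noteq> {}"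
proof -
  define e where "e = insert x (insert y T)"
  have "e \<in> E" using e by (simp add: e_def)
  obtain s :: "'a \<Rightarrow> bool"
    where s[rule_format]: "\<forall>x\<in>e. \<forall>y\<in>e. x \<noteq> y \<longrightarrow> (crossing (e - {x, y}) \<longleftrightarrow> s x \<noteq> s y)"
      and ne: "\<exists>x\<in>e. \<exists>y\<in>e. s x \<noteq> s y"
    using edge_sides[OF \<open>e \<in> E\<close>] .
  have "e - {x, y} = T" using e by (auto simp: e_def)
  then have sxy: "s x = s y" using s[of x y] nc e by (simp add: e_def)
  have sig: "crossing (insert x (T - {r})) \<longleftrightarrow> s r \<noteq> s x" "crossing (insert y (T - {r})) \<longleftrightarrow> s r \<noteq> s x"
    if "r \<in> T" for r
  proof -
    have "e - {r, y} = insert x (T - {r})" "e - {r, x} = insert y (T - {r})" "r \<noteq> x" "r \<noteq> y"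
      using e that by (auto simp: e_def)
    then show "crossing (insert x (T - {r})) \<longleftrightarrow> s r \<noteq> s x"
      "crossing (insert y (T - {r})) \<longleftrightarrow> s r \<noteq> s x"
      using s[of r y] s[of r x] sxy that by (auto simp: e_def)
  qed
  then show "signature T x = signature T y" by (auto simp: signature_def)
  show "signature T x \<noteq> {}"
    using ne sig sxy by (auto simp: signature_def e_def)
qed

text \<open>All neighbours of \<open>T + x\<close> have the signature of \<open>x\<close>, and among three such neighbourhoods two
  meet. So at most two signatures occur.\<close>

lemma signature_cases:
  assumes "\<not> crossing T" "T \<subseteq> V" "card T = k - 2"
    and "x \<in> V - T" "y \<in> V - T" "w \<in> V - T"
  shows "signature T x = signature T y \<or> signature T w = signature T x \<or> signature T w = signature T y"
proof -
  have same: "signature T a = signature T b"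
    if a: "a \<in> V - T" and b: "b \<in> V - T" and z: "z \<in> N (insert a T)" "z \<in> N (insert b T)" for a b z
  proof -
    have "z \<notin> insert a T" "z \<notin> insert b T"
      using N_not_mem z card_insert_link(2)[OF assms(2,3)] a b by blast+
    then show ?thesis
      using signature_edge(1)[OF assms(1), of z a] signature_edge(1)[OF assms(1), of z b] z a b
      by (auto simp: nbh_def)
  qed
  show ?thesis
    using two_of_three_meet[of "insert x T" "insert y T" "insert w T"]
      card_insert_link[OF assms(2,3)] assms(4-6) same by blast
qed

lemma signature_nonempty:
  assumes "\<not> crossing T" "T \<subseteq> V" "card T = k - 2" "x \<in> V - T"
  shows "signature T x \<noteq> {}"
proof -
  obtain y where "insert x (insert y T) \<in> E" "y \<notin> T" "y \<noteq> x"
    using link_extend assms by (metis DiffD1 DiffD2)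
  then show ?thesis using signature_edge(2)[of T x y] assms by auto
qed

text \<open>If the signature of \<open>x\<close> contained \<open>u\<close> and \<open>v\<close>, and that of \<open>y\<close> only \<open>u\<close>, then the easy case
  for the diagonal \<open>v y\<close> determines the colour of \<open>x y\<close>, and the one for the diagonal \<open>v x\<close> gives
  the opposite value.\<close>

lemma signature_not_split:
  assumes "\<not> crossing T" and xy: "x \<in> V - T" "y \<in> V - T" and T: "T \<subseteq> V"
    and "u \<in> signature T x" "v \<in> signature T x" "u \<in> signature T y" "v \<notin> signature T y"
  shows False
proof -
  define R where "R = T - {u, v}"
  have uv: "u \<noteq> v" "u \<in> T" "v \<in> T" using assms by (auto simp: signature_def)
  have "x \<noteq> y" using assms by auto
  have sets: "T = insert u (insert v R)" "T - {u} = insert v R" "T - {v} = insert u R"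
    using uv by (auto simp: R_def)
  have notin: "u \<notin> R" "v \<notin> R" "x \<notin> R" "y \<notin> R" "x \<noteq> u" "x \<noteq> v" "y \<noteq> u" "y \<noteq> v"
    using xy uv by (auto simp: R_def)
  have V: "u \<in> V" "x \<in> V" "y \<in> V" using uv T xy by auto
  have c: "\<not> crossing (insert u (insert v R))" "crossing (insert x (insert v R))"
    "crossing (insert x (insert u R))" "crossing (insert y (insert v R))"
    "\<not> crossing (insert y (insert u R))"
    using assms uv sets by (auto simp: signature_def)
  have "crossing (insert x (insert y R))"
    using four_cycle_if_crossing[OF c(4), of u x] c notin V uv \<open>x \<noteq> y\<close>
    by (simp add: insert_commute)
  then show False
    using four_cycle_if_crossing[OF c(2), of u y] c notin V uv \<open>x \<noteq> y\<close>
    by (simp add: insert_commute)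
qed

text \<open>For signatures with \<open>r\<close> only in that of \<open>x\<close>, with \<open>v\<close> only in that of \<open>y\<close>, and \<open>z\<close> in neither,
  look at an edge that arises from \<open>T - z + x + y\<close> by adding \<open>w\<close>. All five vertices \<open>r, v, x, y, w\<close>
  must be in one class of this edge, and then neither \<open>r\<close> nor \<open>v\<close> is in the signature of \<open>w\<close>. But
  this signature is that of \<open>x\<close> or that of \<open>y\<close>.\<close>

lemma signatures_disjoint_cover:
  assumes nc: "\<not> crossing T" and T: "T \<subseteq> V" "card T = k - 2" and xy: "x \<in> V - T" "y \<in> V - T"
    and r: "r \<in> signature T x" "r \<notin> signature T y"
    and v: "v \<in> signature T y" "v \<notin> signature T x"
    and z: "z \<in> T" "z \<notin> signature T x" "z \<notin> signature T y"
  shows False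
proof -
  define R where "R = T - {r, v, z}"
  have rvz: "r \<in> T" "v \<in> T" "r \<noteq> v" "r \<noteq> z" "v \<noteq> z" using r v z by (auto simp: signature_def)
  have "x \<noteq> y" using r by auto
  have sets: "T = insert r (insert v (insert z R))" "T - {r} = insert v (insert z R)"
    "T - {v} = insert r (insert z R)" "T - {z} = insert r (insert v R)"
    using rvz z by (auto simp: R_def)
  have notin: "r \<notin> R" "v \<notin> R" "z \<notin> R" "x \<notin> R" "y \<notin> R" "x \<noteq> r" "x \<noteq> v" "x \<noteq> z"
    "y \<noteq> r" "y \<noteq> v" "y \<noteq> z"
    using xy rvz z by (auto simp: R_def)
  have V: "r \<in> V" "v \<in> V" "x \<in> V" "y \<in> V" using rvz T xy by auto
  have c: "\<not> crossing (insert r (insert v (insert z R)))"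
    "crossing (insert x (insert v (insert z R)))" "\<not> crossing (insert y (insert v (insert z R)))"
    "\<not> crossing (insert x (insert r (insert z R)))" "crossing (insert y (insert r (insert z R)))"
    "\<not> crossing (insert x (insert r (insert v R)))" "\<not> crossing (insert y (insert r (insert v R)))"
    using nc r v z rvz sets by (auto simp: signature_def)
  have cx: "crossing (insert x (insert z (insert v R)))" using c(2) by (simp add: insert_commute)
  have cy: "crossing (insert y (insert z (insert r R)))" using c(5) by (simp add: insert_commute)
  have eqx: "crossing (insert a (insert x (insert v R))) = crossing (insert a (insert z (insert v R)))"
    if "a \<in> V" "a \<notin> insert x (insert z (insert v R))" for a
    using four_cycle_if_crossing[OF cx _ _ _ _ _ that, of r] c notin V rvz
    by (simp add: insert_commute)
  have eqy: "crossing (insert a (insert y (insert r R))) = crossing (insert a (insert z (insert r R)))"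
    if "a \<in> V" "a \<notin> insert y (insert z (insert r R))" for a
    using four_cycle_if_crossing[OF cy _ _ _ _ _ that, of v] c notin V rvz
    by (simp add: insert_commute)
  have cxyv: "\<not> crossing (insert x (insert y (insert v R)))"
    using eqx[of y] c notin V \<open>x \<noteq> y\<close> by (simp add: insert_commute)
  have cxyr: "\<not> crossing (insert x (insert y (insert r R)))"
    using eqy[of x] c notin V \<open>x \<noteq> y\<close> by (simp add: insert_commute)
  let ?S = "insert x (insert y (insert r (insert v R)))"
  have "finite R" using T fin_V finite_subset unfolding R_def by blast
  then have "card T = Suc (Suc (Suc (card R)))"
    unfolding sets(1) using notin rvz by simp
  moreover have "card ?S = Suc (Suc (Suc (Suc (card R))))"
    using \<open>finite R\<close> notin rvz \<open>x \<noteq> y\<close> by simp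
  ultimately have S: "card ?S = k - 1" "?S \<subseteq> V"
    using T V by (auto simp: R_def)
  obtain w where w: "w \<in> N ?S" using N_nonempty[OF S(2,1)] by blast
  have wS: "w \<notin> ?S" using N_not_mem[OF S(1) w] .
  have "w \<noteq> z"
  proof
    assume "w = z"
    then have "insert x (insert y T) \<in> E" using w by (simp add: nbh_def sets(1) insert_commute)
    then show False using signature_edge(1)[OF nc] xy r \<open>x \<noteq> y\<close> by auto
  qed
  define e where "e = insert w ?S"
  have "e \<in> E" "w \<in> V" using w by (auto simp: e_def nbh_def)
  obtain s :: "'a \<Rightarrow> bool"
    where s[rule_format]: "\<forall>x\<in>e. \<forall>y\<in>e. x \<noteq> y \<longrightarrow> (crossing (e - {x, y}) \<longleftrightarrow> s x \<noteq> s y)"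
      and "\<exists>x\<in>e. \<exists>y\<in>e. s x \<noteq> s y"
    using edge_sides[OF \<open>e \<in> E\<close>] .
  have "e - {v, w} = insert x (insert y (insert r R))" "e - {r, w} = insert x (insert y (insert v R))"
    "e - {x, w} = insert y (insert r (insert v R))" "e - {y, w} = insert x (insert r (insert v R))"
    "e - {r, y} = insert w (insert x (insert v R))" "e - {v, x} = insert w (insert y (insert r R))"
    using notin rvz \<open>x \<noteq> y\<close> wS by (auto simp: e_def)
  then have "\<not> crossing (insert w (insert x (insert v R)))" "\<not> crossing (insert w (insert y (insert r R)))"
    using s[of v w] s[of r w] s[of x w] s[of y w] s[of r y] s[of v x] c cxyv cxyr notin rvz wS
    by (auto simp: e_def)
  then have "\<not> crossing (insert w (insert z (insert v R)))" "\<not> crossing (insert w (insert z (insert r R)))"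
    using eqx[of w] eqy[of w] \<open>w \<in> V\<close> wS \<open>w \<noteq> z\<close> by auto
  then have "r \<notin> signature T w" "v \<notin> signature T w"
    using sets by (auto simp: signature_def insert_commute)
  moreover have "w \<notin> T" using wS \<open>w \<noteq> z\<close> sets(1) by auto
  ultimately show False
    using signature_cases[OF nc T xy, of w] \<open>w \<in> V\<close> r v by auto
qed

text \<open>Nonempty signatures of which neither splits the other are equal or disjoint, and disjoint ones
  cover \<open>T\<close>. In both cases they induce the same partition of \<open>T\<close>.\<close>

lemma signatures_agree:
  assumes "\<not> crossing T" "T \<subseteq> V" "card T = k - 2" and x: "x \<in> V - T" and y: "y \<in> V - T"
  shows "signature T x = signature T y \<or> signature T x = T - signature T y"
proof -
  let ?P = "signature T x" and ?Q = "signature T y"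
  have ne: "?P \<noteq> {}" "?Q \<noteq> {}" using signature_nonempty assms by blast+
  have sub: "?P \<subseteq> T" "?Q \<subseteq> T" by (auto simp: signature_def)
  have "?P \<inter> ?Q = {} \<or> ?P \<subseteq> ?Q" "?P \<inter> ?Q = {} \<or> ?Q \<subseteq> ?P"
    using signature_not_split[OF assms(1) x y assms(2)] signature_not_split[OF assms(1) y x assms(2)]
    by blast+
  then consider "?P = ?Q" | "?P \<inter> ?Q = {}" by blast
  then show ?thesis
  proof cases
    case 2
    then obtain r v where "r \<in> ?P" "r \<notin> ?Q" "v \<in> ?Q" "v \<notin> ?P" using ne by blast
    then have "T \<subseteq> ?P \<union> ?Q"
      using signatures_disjoint_cover[OF assms] by blast
    then show ?thesis using 2 sub by blast
  qed simp
qed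

lemma four_cycle_even:
  assumes R: "insert p (insert q R) \<subseteq> V" "card (insert p (insert q R)) = k - 2"
    and pq: "p \<notin> R" "q \<notin> R" "p \<noteq> q"
    and a: "a \<in> V - insert p (insert q R)" and a': "a' \<in> V - insert p (insert q R)"
  shows "(crossing (insert a (insert p R)) = crossing (insert a (insert q R)))
     = (crossing (insert a' (insert p R)) = crossing (insert a' (insert q R)))"
proof (cases "crossing (insert p (insert q R))")
  case True
  then show ?thesis using four_cycle_if_crossing[OF True pq, of a a'] a a' by blast
next
  case False
  let ?T = "insert p (insert q R)"
  have "p \<in> signature ?T b \<longleftrightarrow> crossing (insert b (insert q R))"
    "q \<in> signature ?T b \<longleftrightarrow> crossing (insert b (insert p R))" for b
  proof -
    have "?T - {p} = insert q R" "?T - {q} = insert p R" using pq by auto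
    then show "p \<in> signature ?T b \<longleftrightarrow> crossing (insert b (insert q R))"
      "q \<in> signature ?T b \<longleftrightarrow> crossing (insert b (insert p R))"
      by (simp_all add: signature_def)
  qed
  moreover have "p \<in> ?T" "q \<in> ?T" by auto
  ultimately show ?thesis
    using signatures_agree[OF False R a a'] by blast
qed

end
section \<open>The vertex set behind the crossing family\<close>

lemma constant_if_exchange_invariant:
  assumes "finite U"
    and ex: "\<And>R x y. R \<subseteq> U \<Longrightarrow> x \<in> U - R \<Longrightarrow> y \<in> U - R \<Longrightarrow> card (insert x R) = m
      \<Longrightarrow> F (insert x R) = F (insert y R)"
    and "A \<subseteq> U" "A' \<subseteq> U" "card A = m" "card A' = m"
  shows "F A = F A'"
  using assms(3,5)
proof (induction "card (A - A')" arbitrary: A rule: less_induct)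
  case less
  have fin: "finite A" "finite A'" using less.prems assms(1,4) finite_subset by blast+
  show ?case
  proof (cases "A \<subseteq> A'")
    case True
    then show ?thesis using card_subset_eq[OF fin(2)] less.prems assms(6) by auto
  next
    case False
    then obtain x where x: "x \<in> A" "x \<notin> A'" by blast
    have "\<not> A' \<subseteq> A" using card_subset_eq[OF fin(1), of A'] less.prems assms(6) x by auto
    then obtain y where y: "y \<in> A'" "y \<notin> A" by blast
    let ?R = "A - {x}"
    have A: "A = insert x ?R" using x by auto
    have "F (insert x ?R) = F (insert y ?R)"
      using less.prems x y assms(4) A by (intro ex) auto
    moreover have "F (insert y ?R) = F A'"
    proof (rule less.hyps)
      have "insert y ?R - A' \<subset> A - A'" using x y by auto
      then show "card (insert y ?R - A') < card (A - A')" using fin by (intro psubset_card_mono) auto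
      show "insert y ?R \<subseteq> U" using less.prems y assms(4) by auto
      have "card (insert y ?R) = Suc (card ?R)" using fin y by simp
      then show "card (insert y ?R) = m" using card_Suc_Diff1[OF fin(1) x(1)] less.prems by simp
    qed
    ultimately show ?thesis using A by simp
  qed
qed

context tight_cycle_free
begin

text \<open>Evenness of 4-cycles is the statement that the effect of exchanging \<open>u\<close> for \<open>v\<close> does not
  change when one vertex of \<open>R\<close> is exchanged, and exchanges connect all choices of \<open>R\<close>.\<close>

lemma crossing_shift_independent:
  assumes uv: "u \<in> V" "v \<in> V" "u \<noteq> v"
    and R: "R \<subseteq> V - {u, v}" "R' \<subseteq> V - {u, v}" "card R = k - 3" "card R' = k - 3"
  shows "(crossing (insert u R) = crossing (insert v R))
     = (crossing (insert u R') = crossing (insert v R'))"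
proof (rule constant_if_exchange_invariant[where
      F = "\<lambda>R. crossing (insert u R) = crossing (insert v R)", OF _ _ R])
  show "finite (V - {u, v})" using fin_V by simp
next
  fix Q x y
  assume Q: "Q \<subseteq> V - {u, v}" "x \<in> V - {u, v} - Q" "y \<in> V - {u, v} - Q" "card (insert x Q) = k - 3"
  have "finite Q" using Q(1) fin_V finite_subset by blast
  moreover have "u \<notin> Q" "v \<notin> Q" using Q(1) by blast+
  ultimately have "card (insert u (insert v Q)) = k - 2" using Q uv by auto
  then show "(crossing (insert u (insert x Q)) = crossing (insert v (insert x Q)))
     = (crossing (insert u (insert y Q)) = crossing (insert v (insert y Q)))"
    using four_cycle_even[of u v Q x y] Q uv by (auto simp: insert_commute)
qed

lemma edge_exists: "E \<noteq> {}"
proof -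
  obtain S where S: "S \<subseteq> V" "card S = k - 1"
    using obtain_subset_with_card_n[OF card_V_ge] by blast
  then show ?thesis using N_nonempty[OF S] by (auto simp: nbh_def)
qed

lemma card_V: "k \<le> card V"
proof -
  obtain e where "e \<in> E" using edge_exists by blast
  then show ?thesis using edge_card edge_sub card_mono[OF fin_V] by metis
qed

definition governs_crossing :: "'a set \<Rightarrow> bool" where
  "governs_crossing B \<longleftrightarrow> (\<forall>R u v. R \<subseteq> V \<longrightarrow> card R = k - 3 \<longrightarrow> u \<in> V - R \<longrightarrow> v \<in> V - R \<longrightarrow>
    (crossing (insert u R) \<noteq> crossing (insert v R)) = ((u \<in> B) \<noteq> (v \<in> B)))"

text \<open>Fixing a vertex \<open>b\<close>, the set \<open>B\<close> consists of the vertices whose exchange with \<open>b\<close> changes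
  whether a set is crossing. Any two vertices and \<open>b\<close> leave room for a common set \<open>R\<close>, which
  makes this consistent.\<close>

lemma side_set_exists:
  obtains B where "B \<subseteq> V" and "governs_crossing B"
proof -
  obtain b where b: "b \<in> V" using card_V k_ge_3 by fastforce
  define B where "B = {v \<in> V. v \<noteq> b \<and> (\<exists>R \<subseteq> V - {v, b}. card R = k - 3
    \<and> crossing (insert v R) \<noteq> crossing (insert b R))}"
  have base: "(crossing (insert v R) \<noteq> crossing (insert b R)) = (v \<in> B)"
    if "v \<in> V" "R \<subseteq> V - {v, b}" "card R = k - 3" for v R
  proof (cases "v = b")
    case False
    show ?thesis
      using crossing_shift_independent[OF that(1) b False _ that(2) _ that(3)] that False
      unfolding B_def by blast
  qed (simp add: B_def)
  have "(crossing (insert u R) \<noteq> crossing (insert v R)) = ((u \<in> B) \<noteq> (v \<in> B))"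
    if R: "R \<subseteq> V" "card R = k - 3" and u: "u \<in> V - R" and v: "v \<in> V - R" for R u v
  proof (cases "u = v")
    case False
    have room: "k - 3 \<le> card (V - {u, v, b})"
    proof -
      have "card V - card {u, v, b} \<le> card (V - {u, v, b})" by (rule diff_card_le_card_Diff) simp
      moreover have "card {u, v, b} \<le> 3" by (simp add: card_insert_if)
      ultimately show ?thesis using card_V by linarith
    qed
    obtain Q where Q: "Q \<subseteq> V - {u, v, b}" "card Q = k - 3"
      using obtain_subset_with_card_n[OF room] by blast
    have "(crossing (insert u R) = crossing (insert v R))
        = (crossing (insert u Q) = crossing (insert v Q))"
      using u v R Q False by (intro crossing_shift_independent) auto
    moreover have "(crossing (insert u Q) \<noteq> crossing (insert b Q)) = (u \<in> B)"
      "(crossing (insert v Q) \<noteq> crossing (insert b Q)) = (v \<in> B)"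
      using base[of u Q] base[of v Q] u v Q by auto
    ultimately show ?thesis by blast
  qed simp
  then show thesis
    by (intro that[of B]) (simp_all add: B_def governs_crossing_def)
qed

text \<open>Comparing two vertices of an edge with a third one shows that the classes of the edge are its
  intersections with \<open>B\<close> and with the complement of \<open>B\<close>.\<close>

lemma crossing_iff_separated:
  assumes B: "governs_crossing B"
    and e: "e \<in> E" and xy: "x \<in> e" "y \<in> e" "x \<noteq> y"
  shows "crossing (e - {x, y}) \<longleftrightarrow> (x \<in> B) \<noteq> (y \<in> B)"
proof -
  obtain s :: "'a \<Rightarrow> bool"
    where s[rule_format]: "\<forall>x\<in>e. \<forall>y\<in>e. x \<noteq> y \<longrightarrow> (crossing (e - {x, y}) \<longleftrightarrow> s x \<noteq> s y)"
      and "\<exists>x\<in>e. \<exists>y\<in>e. s x \<noteq> s y"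
    using edge_sides[OF e] .
  have "card (e - {x, y}) = k - 2"
    using edge_card[OF e] edge_finite[OF e] xy by (simp add: card_Diff_subset)
  then have "card (e - {x, y}) \<noteq> 0" using k_ge_3 by simp
  then have "e - {x, y} \<noteq> {}" by (metis card.empty)
  then obtain w where w: "w \<in> e" "w \<noteq> x" "w \<noteq> y" by blast
  define R where "R = e - {x, y, w}"
  have "card R = k - 3"
    using edge_card[OF e] edge_finite[OF e] xy w by (simp add: R_def card_Diff_subset)
  moreover have "R \<subseteq> V" "x \<in> V - R" "y \<in> V - R" using edge_sub[OF e] xy by (auto simp: R_def)
  ultimately have "(crossing (insert x R) \<noteq> crossing (insert y R)) = ((x \<in> B) \<noteq> (y \<in> B))"
    using B unfolding governs_crossing_def by blast
  moreover have "insert x R = e - {y, w}" "insert y R = e - {x, w}"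
    using xy w by (auto simp: R_def)
  ultimately show ?thesis using s[of y w] s[of x w] s[of x y] xy w by auto
qed

text \<open>For \<open>T \<subseteq> e\<close> with \<open>k - 2\<close> elements, the parity of \<open>e \<inter> B\<close> is determined by that of \<open>T \<inter> B\<close> and
  by whether \<open>T\<close> is crossing; exchanging a vertex of \<open>T\<close> changes both or neither.\<close>

lemma edge_parity_constant:
  assumes BV: "B \<subseteq> V"
    and B: "governs_crossing B"
    and e: "e \<in> E" "e' \<in> E"
  shows "even (card (e \<inter> B)) = even (card (e' \<inter> B))"
proof -
  define F where "F T = (even (card (T \<inter> B)) = crossing T)" for T
  have card_insert: "card (insert x T \<inter> B) = (if x \<in> B then 1 else 0) + card (T \<inter> B)"
    if "finite T" "x \<notin> T" for x T
    using that by (simp add: Int_insert_left)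
  have "\<exists>T \<subseteq> V. card T = k - 2 \<and> even (card (e \<inter> B)) = (\<not> F T)" if e: "e \<in> E" for e
  proof -
    have "\<not> card e \<le> Suc 0" using edge_card[OF e] k_ge_3 by simp
    then obtain x y where xy: "x \<in> e" "y \<in> e" "x \<noteq> y"
      using card_le_Suc0_iff_eq[OF edge_finite[OF e]] by blast
    define T where "T = e - {x, y}"
    have eT: "e = insert x (insert y T)" "x \<notin> insert y T" "y \<notin> T" "finite T"
      using xy edge_finite[OF e] by (auto simp: T_def)
    have "crossing T \<longleftrightarrow> (x \<in> B) \<noteq> (y \<in> B)"
      unfolding T_def by (rule crossing_iff_separated[OF B e xy])
    moreover have "card (e \<inter> B) = (if x \<in> B then 1 else 0) + ((if y \<in> B then 1 else 0) + card (T \<inter> B))"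
      unfolding eT(1) using card_insert eT by simp
    ultimately have "even (card (e \<inter> B)) = (\<not> F T)"
      by (auto simp: F_def)
    moreover have "T \<subseteq> V" "card T = k - 2"
      using card_link[of x y T] e eT by auto
    ultimately show ?thesis by blast
  qed
  then obtain T T' where T: "T \<subseteq> V" "card T = k - 2" "even (card (e \<inter> B)) = (\<not> F T)"
    and T': "T' \<subseteq> V" "card T' = k - 2" "even (card (e' \<inter> B)) = (\<not> F T')"
    using e by meson
  have "F T = F T'"
  proof (rule constant_if_exchange_invariant[OF fin_V _ T(1) T'(1) T(2) T'(2)])
    fix R x y
    assume R: "R \<subseteq> V" "x \<in> V - R" "y \<in> V - R" "card (insert x R) = k - 2"
    have "finite R" using R fin_V finite_subset by blast
    then have "card R = k - 3" using R by simp
    then have "(crossing (insert x R) \<noteq> crossing (insert y R)) = ((x \<in> B) \<noteq> (y \<in> B))"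
      using B R unfolding governs_crossing_def by blast
    then show "F (insert x R) = F (insert y R)"
      using card_insert[OF \<open>finite R\<close>, of x] card_insert[OF \<open>finite R\<close>, of y] R
      by (auto simp: F_def)
  qed
  then show ?thesis using T T' by simp
qed

text \<open>If every edge met \<open>C\<close> in a nonempty even set, then a \<open>(k-1)\<close>-set outside \<open>C\<close> would have no
  neighbour. If there is no such set, then all but one vertex \<open>d\<close> outside \<open>C\<close> can be put into a
  \<open>(k-1)\<close>-set whose parity leaves \<open>d\<close> as its only neighbour.\<close>

lemma not_all_even:
  assumes C: "C \<subseteq> V" and e: "\<forall>e\<in>E. even (card (e \<inter> C)) \<and> e \<inter> C \<noteq> {} \<and> e - C \<noteq> {}"
  shows False
proof (cases "k - 1 \<le> card (V - C)")
  case True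
  obtain S where S: "S \<subseteq> V - C" "card S = k - 1"
    using obtain_subset_with_card_n[OF True] by blast
  then obtain w where w: "w \<in> N S" using N_nonempty[of S] by blast
  then have "insert w S \<in> E" "insert w S \<inter> C \<subseteq> {w}" using S by (auto simp: nbh_def)
  then have "insert w S \<inter> C = {w}" "even (card (insert w S \<inter> C))" using e by blast+
  then show False by simp
next
  case False
  let ?D = "V - C"
  obtain d where d: "d \<in> ?D"
    using edge_exists e edge_sub by blast
  have fin: "finite ?D" using fin_V by simp
  obtain S where S: "?D \<subseteq> S" "S \<subseteq> V" "card S = k - 1"
    using exists_subset_between[of ?D "k - 1" V] False card_V_ge fin_V by auto
  have finS: "finite S" using S fin_V finite_subset by blast
  obtain w where w: "w \<in> N S" "w \<notin> S" using N_nonempty[of S] N_not_mem[OF S(3)] S by blast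
  have wC: "w \<in> C" "insert w S \<in> E" using w S by (auto simp: nbh_def)
  define S' where "S' = insert w (S - {d})"
  have dS: "d \<in> S" "d \<noteq> w" using d S wC by auto
  have S': "S' \<subseteq> V" "card S' = k - 1"
    using S w dS finS by (auto simp: S'_def nbh_def)
  have "insert w S \<inter> C = S' \<inter> C" using d by (auto simp: S'_def)
  then have ev: "even (card (S' \<inter> C))" using e wC by metis
  have "N S' \<subseteq> {d}"
  proof
    fix x assume x: "x \<in> N S'"
    have xS: "x \<notin> S'" using N_not_mem[OF S'(2) x] .
    have "x \<notin> C"
    proof
      assume "x \<in> C"
      then have "card (insert x S' \<inter> C) = Suc (card (S' \<inter> C))"
        using xS finS by (simp add: Int_insert_left S'_def)
      moreover have "even (card (insert x S' \<inter> C))" using e x by (simp add: nbh_def)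
      ultimately show False using ev by simp
    qed
    then show "x \<in> {d}" using x xS S(1) by (auto simp: nbh_def S'_def)
  qed
  then have "card (N S') \<le> 1" using card_mono[of "{d}" "N S'"] by simp
  then show False using dense[OF S'] card_V k_ge_3 by linarith
qed

lemma odd_bipartition:
  "\<exists>B\<subseteq>V. card V < 3 * card B \<and> card V < 3 * card (V - B)
    \<and> (\<forall>e\<in>E. odd (card (e \<inter> B)) \<and> odd (card (e \<inter> (V - B))))"
proof -
  obtain B where BV: "B \<subseteq> V"
    and B: "governs_crossing B"
    using side_set_exists .
  have meets: "\<exists>x\<in>e. \<exists>y\<in>e. x \<in> B \<and> y \<notin> B" if e: "e \<in> E" for e
  proof -
    obtain s :: "'a \<Rightarrow> bool"
      where s[rule_format]: "\<forall>x\<in>e. \<forall>y\<in>e. x \<noteq> y \<longrightarrow> (crossing (e - {x, y}) \<longleftrightarrow> s x \<noteq> s y)"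
        and ne: "\<exists>x\<in>e. \<exists>y\<in>e. s x \<noteq> s y"
      using edge_sides[OF e] .
    then obtain x y where "x \<in> e" "y \<in> e" "x \<noteq> y" "crossing (e - {x, y})" by metis
    then show ?thesis using crossing_iff_separated[OF B e] by blast
  qed
  obtain e0 where e0: "e0 \<in> E" using edge_exists by blast
  note const = edge_parity_constant[OF BV B _ e0]
  have odd1: "odd (card (e \<inter> B))" if "e \<in> E" for e
  proof
    assume "even (card (e \<inter> B))"
    then have "\<forall>e\<in>E. even (card (e \<inter> B))" using const that by blast
    then show False using not_all_even[OF BV] meets by blast
  qed
  have odd2: "odd (card (e \<inter> (V - B)))" if "e \<in> E" for e
  proof
    assume "even (card (e \<inter> (V - B)))"
    then have "odd k" using card_edge_split[OF that BV] odd1[OF that] by presburger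
    then have "\<forall>e\<in>E. even (card (e \<inter> (V - B)))" using card_edge_split[OF _ BV] odd1 by (metis even_add)
    then show False using not_all_even[of "V - B"] meets edge_sub by blast
  qed
  obtain x y where xy: "x \<in> e0" "y \<in> e0" "x \<in> B" "y \<notin> B" using meets[OF e0] by blast
  \<comment> \<open>As all edges have the same parity, the neighbourhoods of \<open>e0 - {x}\<close> and \<open>e0 - {y}\<close> lie on
    one side each; both have more than a third of all vertices.\<close>
  have parity: "w \<in> B \<longleftrightarrow> z \<in> B" if z: "z \<in> e0" and w: "w \<in> N (e0 - {z})" for z w
  proof -
    have notin: "w \<notin> e0 - {z}" using N_not_mem edge_minus_vertex[OF e0 z] w by blast
    have E: "insert w (e0 - {z}) \<in> E" "insert z (e0 - {z}) \<in> E"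
      using w e0 z by (simp_all add: nbh_def insert_absorb)
    have "card (insert v (e0 - {z}) \<inter> B) = (if v \<in> B then 1 else 0) + card ((e0 - {z}) \<inter> B)"
      if "v \<notin> e0 - {z}" for v
      using that edge_finite[OF e0] by (simp add: Int_insert_left)
    from this[OF notin] this[of z] show ?thesis
      using odd1[OF E(1)] odd1[OF E(2)] by (auto split: if_splits)
  qed
  have "N (e0 - {x}) \<subseteq> B" "N (e0 - {y}) \<subseteq> V - B"
    using parity xy by (auto simp: nbh_def)
  then have "card (N (e0 - {x})) \<le> card B" "card (N (e0 - {y})) \<le> card (V - B)"
    using BV fin_V finite_subset by (auto intro!: card_mono)
  then have "card V < 3 * card B" "card V < 3 * card (V - B)"
    using dense[OF edge_minus_vertex[OF e0 xy(1)]] dense[OF edge_minus_vertex[OF e0 xy(2)]] by auto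
  then show ?thesis using BV odd1 odd2 by blast
qed

end

theorem theorem1p2:
  fixes k l :: nat and V :: "'a set" and E :: "'a set set"
  assumes "3 \<le> k" and "k < l"
    and "\<not> k dvd l"
    and "l \<ge> 20 * k ^ 2"
    and "uniform_hypergraph k V E"
    and "card V \<ge> k - 1"
    and "\<not> contains_hom_copy V E (tight_cycle_verts l) (tight_cycle_edges k l)"
    and "real (min_codegree k V E) > 1 / 3 * real (card V)"
  shows "(\<exists>B\<subseteq>V. real (card V) / 3 \<le> real (card B) \<and> real (card B) \<le> 2 * real (card V) / 3
            \<and> (\<forall>e\<in>E. odd (card (e \<inter> B)) \<and> odd (card (e \<inter> (V - B)))))
         \<and> even k"
proof -
  have fin: "finite V" and edge: "\<And>e. e \<in> E \<Longrightarrow> e \<subseteq> V \<and> card e = k"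
    using assms(5) by (auto simp: uniform_hypergraph_def)
  have "card V < 3 * card (nbh V E S)" if "S \<subseteq> V" "card S = k - 1" for S
  proof -
    have "min_codegree k V E \<le> codegree V E S"
      unfolding min_codegree_def using that fin by (intro Min_le) auto
    then show ?thesis using assms(8) by (simp add: codegree_def nbh_def)
  qed
  then interpret tight_cycle_free k V E l
    using assms fin edge by unfold_locales auto
  obtain B where B: "B \<subseteq> V" "card V < 3 * card B" "card V < 3 * card (V - B)"
    "\<forall>e\<in>E. odd (card (e \<inter> B)) \<and> odd (card (e \<inter> (V - B)))"
    using odd_bipartition by blast
  have "card B + card (V - B) = card V"
    using card_Diff_subset[of B V] card_mono[OF fin B(1)] finite_subset[OF B(1) fin] B(1) by simp
  then have "real (card V) / 3 \<le> real (card B)" "real (card B) \<le> 2 * real (card V) / 3"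
    using B by linarith+
  moreover have "even k"
  proof -
    obtain e where e: "e \<in> E" using edge_exists by blast
    have "card (e \<inter> B) + card (e \<inter> (V - B)) = k" by (rule card_edge_split[OF e B(1)])
    then show ?thesis using B(4) e by (metis even_add)
  qed
  ultimately show ?thesis using B by blast
qed

end
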